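(* Let $\mathcal{H}$ be a complex Hilbert space. A pair of densely defined operators $(T_0,\widetilde{T}_0)$ on $\mathcal{H}$ satisfies both (a) $T_0$ and $\widetilde{T}_0$ have a common domain $\mathcal{D}=\operatorname{dom}T_0=\operatorname{dom}\widetilde{T}_0$, dense in $\mathcal{H}$, and $\langle T_0\phi\mid\psi\rangle=\langle\phi\mid\widetilde{T}_0\psi\rangle$ for all $\phi,\psi\in\mathcal{D}$, and (b) there is a constant $\lambda>0$ such that $\|(T_0+\widetilde{T}_0)\phi\|\le 2\lambda\|\phi\|$ for all $\phi\in\mathcal{D}$, if and only if there exist a densely defined skew-symmetric operator $L_0$ and a bounded self-adjoint operator $S$, both on $\mathcal{H}$, such that $$T_0=L_0+S \qquad\text{and}\qquad \widetilde{T}_0=-L_0+S .$$ For a given pair, this decomposition is unique. If, in addition to (a) and (b), one includes the requirement that there is a constant $\mu>0$ such that $\langle (T_0+\widetilde{T}_0)\phi\mid\phi\rangle\ge 2\mu\|\phi\|^2$ for all $\phi\in\mathcal{D}$, then the same holds with $S$ being strictly positive, i.e. $$\langle Su\mid u\rangle\ \ge\ \mu\|u\|^2,\qquad u\in\mathcal{H},$$ where $\mu>0$ is the constant appearing in this additional requirement.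
   Context: $\langle\cdot\mid\cdot\rangle$ is the scalar product of $\mathcal{H}$, anti-linear in the second entry, and $\|\cdot\|$ is the corresponding norm. All operators are linear. A densely defined operator $L_0$ is skew-symmetric if $-L_0\subseteq L_0^*$. Bounded operators are defined on all of $\mathcal{H}$, and $L_0+S$ has domain $\operatorname{dom}L_0$. *)

theory Defs
  imports "HOL-Analysis.Analysis" "HOL-Library.Complex_Order"
begin

text \<open>The complex structure is added on top of the real Banach space class, so that closure,
  norm and completeness are those of the library.\<close>

class complex_vector_space = real_vector +
  fixes scaleC :: "complex \<Rightarrow> 'a \<Rightarrow> 'a"  (infixr \<open>*\<^sub>C\<close> 75)
  assumes scaleC_add_right: "c *\<^sub>C (x + y) = c *\<^sub>C x + c *\<^sub>C y"
    and scaleC_add_left: "(c + d) *\<^sub>C x = c *\<^sub>C x + d *\<^sub>C x"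
    and scaleC_scaleC: "c *\<^sub>C d *\<^sub>C x = (c * d) *\<^sub>C x"
    and scaleC_of_real: "complex_of_real r *\<^sub>C x = r *\<^sub>R x"

text \<open>The scalar product is antilinear in its second argument. Positive definiteness is contained
  in the last axiom, which ties the norm to the scalar product.\<close>

class complex_hilbert_space = complex_vector_space + banach +
  fixes cinner :: "'a \<Rightarrow> 'a \<Rightarrow> complex"
  assumes cinner_add_left: "cinner (x + y) z = cinner x z + cinner y z"
    and cinner_scaleC_left: "cinner (c *\<^sub>C x) y = c * cinner x y"
    and cinner_commute: "cinner y x = cnj (cinner x y)"
    and cinner_self: "cinner x x = complex_of_real ((norm x)\<^sup>2)"

global_interpretation complex_vector: vector_space
  "scaleC :: complex \<Rightarrow> 'a \<Rightarrow> 'a::complex_vector_space"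
proof
  show "1 *\<^sub>C x = x" for x :: 'a
    using scaleC_of_real[of 1 x] by simp
qed (rule scaleC_add_right scaleC_add_left scaleC_scaleC)+

text \<open>An operator is a partial function, so that equality of operators includes equality of
  domains, and the extension relation between operators is \<open>(\<subseteq>\<^sub>m)\<close>.\<close>

type_synonym 'a operator = "'a \<rightharpoonup> 'a"

abbreviation op_apply :: "'a operator \<Rightarrow> 'a \<Rightarrow> 'a"  (infixl \<open>\<cdot>\<close> 100)
  where "T \<cdot> x \<equiv> the (T x)"

definition linear_operator :: "'a::complex_vector_space operator \<Rightarrow> bool"
  where "linear_operator T \<longleftrightarrow>
    complex_vector.subspace (dom T) \<and>
    (\<forall>x\<in>dom T. \<forall>y\<in>dom T. T \<cdot> (x + y) = T \<cdot> x + T \<cdot> y) \<and>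
    (\<forall>c. \<forall>x\<in>dom T. T \<cdot> (c *\<^sub>C x) = c *\<^sub>C (T \<cdot> x))"

definition densely_defined :: "'a::topological_space operator \<Rightarrow> bool"
  where "densely_defined T \<longleftrightarrow> closure (dom T) = UNIV"

definition op_add :: "'a::plus operator \<Rightarrow> 'a operator \<Rightarrow> 'a operator"  (infixl \<open>\<oplus>\<close> 65)
  where "T \<oplus> U = (\<lambda>x. Some (T \<cdot> x + U \<cdot> x)) |` (dom T \<inter> dom U)"

definition op_uminus :: "'a::uminus operator \<Rightarrow> 'a operator"  (\<open>\<ominus> _\<close> [81] 80)
  where "\<ominus> T = (\<lambda>x. Some (- (T \<cdot> x))) |` dom T"

text \<open>The description operator below is meaningful only for densely defined \<open>T\<close>, where the
  vector \<open>z\<close> is uniquely determined by \<open>y\<close>.\<close>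

definition adjoint_op :: "'a::complex_hilbert_space operator \<Rightarrow> 'a operator"
  where "adjoint_op T =
    (\<lambda>y. Some (THE z. \<forall>x\<in>dom T. cinner (T \<cdot> x) y = cinner x z)) |`
      {y. \<exists>z. \<forall>x\<in>dom T. cinner (T \<cdot> x) y = cinner x z}"

definition skew_symmetric :: "'a::complex_hilbert_space operator \<Rightarrow> bool"
  where "skew_symmetric L \<longleftrightarrow>
    linear_operator L \<and> densely_defined L \<and> \<ominus> L \<subseteq>\<^sub>m adjoint_op L"

definition bounded_operator :: "'a::complex_hilbert_space operator \<Rightarrow> bool"
  where "bounded_operator S \<longleftrightarrow>
    linear_operator S \<and> dom S = UNIV \<and> (\<exists>C. \<forall>x. norm (S \<cdot> x) \<le> C * norm x)"

definition self_adjoint :: "'a::complex_hilbert_space operator \<Rightarrow> bool"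
  where "self_adjoint S \<longleftrightarrow>
    linear_operator S \<and> densely_defined S \<and> adjoint_op S = S"

definition cond_a :: "'a::complex_hilbert_space operator \<Rightarrow> 'a operator \<Rightarrow> bool"
  where "cond_a T T' \<longleftrightarrow>
    dom T = dom T' \<and> closure (dom T) = UNIV \<and>
    (\<forall>\<phi>\<in>dom T. \<forall>\<psi>\<in>dom T. cinner (T \<cdot> \<phi>) \<psi> = cinner \<phi> (T' \<cdot> \<psi>))"

definition cond_b :: "'a::complex_hilbert_space operator \<Rightarrow> 'a operator \<Rightarrow> bool"
  where "cond_b T T' \<longleftrightarrow>
    (\<exists>lam>0. \<forall>\<phi>\<in>dom (T \<oplus> T'). norm ((T \<oplus> T') \<cdot> \<phi>) \<le> 2 * lam * norm \<phi>)"

text \<open>In the next two definitions \<open>\<le>\<close> is the order of \<^theory>\<open>HOL-Library.Complex_Order\<close>: the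
  scalar product on the right is asserted to be real and bounded below.\<close>

definition cond_c :: "real \<Rightarrow> 'a::complex_hilbert_space operator \<Rightarrow> 'a operator \<Rightarrow> bool"
  where "cond_c \<mu> T T' \<longleftrightarrow>
    (\<forall>\<phi>\<in>dom (T \<oplus> T'). complex_of_real (2 * \<mu> * (norm \<phi>)\<^sup>2) \<le> cinner ((T \<oplus> T') \<cdot> \<phi>) \<phi>)"

definition strictly_positive :: "real \<Rightarrow> 'a::complex_hilbert_space operator \<Rightarrow> bool"
  where "strictly_positive \<mu> S \<longleftrightarrow>
    (\<forall>u\<in>dom S. complex_of_real (\<mu> * (norm u)\<^sup>2) \<le> cinner (S \<cdot> u) u)"

definition decomposition ::
    "'a::complex_hilbert_space operator \<Rightarrow> 'a operator \<Rightarrow> 'a operator \<Rightarrow> 'a operator \<Rightarrow> bool"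
  where "decomposition T T' L S \<longleftrightarrow>
    skew_symmetric L \<and> bounded_operator S \<and> self_adjoint S \<and>
    T = L \<oplus> S \<and> T' = \<ominus> L \<oplus> S"

end

theory Submission
  imports Defs
begin

text \<open>The bounded operator \<open>S\<close> has to be the continuous extension of \<open>(T\<^sub>0 + T\<^sub>0') / 2\<close>, which exists
  because \<open>T\<^sub>0 + T\<^sub>0'\<close> is bounded on a dense subspace, and \<open>L\<^sub>0\<close> has to be \<open>(T\<^sub>0 - T\<^sub>0') / 2\<close>. Formal
  adjointness of the pair makes \<open>(T\<^sub>0 + T\<^sub>0') / 2\<close> symmetric and \<open>(T\<^sub>0 - T\<^sub>0') / 2\<close> skew-symmetric;
  symmetry, positivity and uniqueness of \<open>S\<close> pass from the dense domain to the whole space by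
  continuity of the scalar product.\<close>

section \<open>The scalar product\<close>

lemma cinner_add_right:
  fixes x y z :: "'a::complex_hilbert_space"
  shows "cinner x (y + z) = cinner x y + cinner x z"
  by (metis cinner_add_left cinner_commute complex_cnj_add)

lemma cinner_scaleC_right:
  fixes x y :: "'a::complex_hilbert_space"
  shows "cinner x (c *\<^sub>C y) = cnj c * cinner x y"
  by (metis cinner_commute cinner_scaleC_left complex_cnj_mult)

lemma cinner_minus_left:
  fixes x y :: "'a::complex_hilbert_space"
  shows "cinner (- x) y = - cinner x y"
  using cinner_scaleC_left[of "-1" x y] by simp

lemma cinner_minus_right:
  fixes x y :: "'a::complex_hilbert_space"
  shows "cinner x (- y) = - cinner x y"
  using cinner_scaleC_right[of x "-1" y] by simp

lemma cinner_diff_left: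
  fixes x y z :: "'a::complex_hilbert_space"
  shows "cinner (x - y) z = cinner x z - cinner y z"
  using cinner_add_left[of x "- y" z] by (simp add: cinner_minus_left)

lemma cinner_diff_right:
  fixes x y z :: "'a::complex_hilbert_space"
  shows "cinner x (y - z) = cinner x y - cinner x z"
  using cinner_add_right[of x y "- z"] by (simp add: cinner_minus_right)

lemma cinner_scaleR_left:
  fixes x y :: "'a::complex_hilbert_space"
  shows "cinner (r *\<^sub>R x) y = complex_of_real r * cinner x y"
  by (metis cinner_scaleC_left scaleC_of_real)

lemma cinner_scaleR_right:
  fixes x y :: "'a::complex_hilbert_space"
  shows "cinner x (r *\<^sub>R y) = complex_of_real r * cinner x y"
  by (metis cinner_scaleC_right scaleC_of_real complex_cnj_complex_of_real)

text \<open>The norm axioms cover real scaling only. The complex case follows from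
  \<open>cinner_self\<close>: pulling \<open>c\<close> out of both arguments leaves the factor
  \<open>c * cnj c\<close>, the square of \<open>cmod c\<close>.\<close>

lemma norm_scaleC:
  fixes x :: "'a::complex_hilbert_space"
  shows "norm (c *\<^sub>C x) = cmod c * norm x"
proof -
  have "complex_of_real ((norm (c *\<^sub>C x))\<^sup>2) = c * cnj c * cinner x x"
    by (simp only: cinner_self[symmetric] cinner_scaleC_left cinner_scaleC_right mult_ac)
  also have "\<dots> = complex_of_real ((cmod c * norm x)\<^sup>2)"
    by (simp add: cinner_self complex_norm_square[symmetric] power_mult_distrib)
  finally have "(norm (c *\<^sub>C x))\<^sup>2 = (cmod c * norm x)\<^sup>2"
    using of_real_eq_iff by blast
  then show ?thesis
    by (simp add: power2_eq_iff_nonneg)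
qed

text \<open>The topology comes from the real structure, in which scaling by a fixed complex
  \<open>c\<close> is a bounded real-linear map.\<close>

lemma continuous_on_scaleC:
  fixes f :: "'b::topological_space \<Rightarrow> 'a::complex_hilbert_space"
  assumes "continuous_on A f"
  shows "continuous_on A (\<lambda>x. c *\<^sub>C f x)"
proof -
  have "bounded_linear (\<lambda>x::'a. c *\<^sub>C x)"
  proof (rule bounded_linear_intro[where K = "cmod c"])
    show "c *\<^sub>C (x + y) = c *\<^sub>C x + c *\<^sub>C y" for x y :: 'a
      by (rule scaleC_add_right)
    show "c *\<^sub>C (r *\<^sub>R x) = r *\<^sub>R (c *\<^sub>C x)" for r and x :: 'a
      by (metis scaleC_of_real scaleC_scaleC mult.commute)
    show "norm (c *\<^sub>C x) \<le> norm x * cmod c" for x :: 'a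
      by (simp add: norm_scaleC)
  qed
  then show ?thesis
    using assms by (rule bounded_linear.continuous_on)
qed

text \<open>In the expansion of the squared norm of \<open>x + y\<close> the mixed terms are
  conjugate to each other and add up to twice a real part. This reduces continuity of the scalar
  product to that of the norm.\<close>

lemma Re_cinner_polarization:
  fixes x y :: "'a::complex_hilbert_space"
  shows "Re (cinner x y) = ((norm (x + y))\<^sup>2 - (norm x)\<^sup>2 - (norm y)\<^sup>2) / 2"
proof -
  have n: "Re (cinner z z) = (norm z)\<^sup>2" for z :: 'a
    by (simp add: cinner_self)
  have "(norm (x + y))\<^sup>2 = Re (cinner (x + y) (x + y))"
    by (simp add: n)
  also have "\<dots> = (norm x)\<^sup>2 + (norm y)\<^sup>2 + 2 * Re (cinner x y)"
    using cinner_commute[of x y] by (simp add: cinner_add_left cinner_add_right n)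
  finally show ?thesis
    by simp
qed

lemma Im_cinner:
  fixes x y :: "'a::complex_hilbert_space"
  shows "Im (cinner x y) = Re (cinner ((- \<i>) *\<^sub>C x) y)"
  by (simp only: cinner_scaleC_left) simp

text \<open>No Cauchy-Schwarz inequality is invoked: polarization writes the real part through
  norms, and a rotation of \<open>f x\<close> by \<open>- \<i>\<close> does the same for the
  imaginary part.\<close>

lemma continuous_on_cinner:
  fixes f g :: "'b::topological_space \<Rightarrow> 'a::complex_hilbert_space"
  assumes "continuous_on A f" and "continuous_on A g"
  shows "continuous_on A (\<lambda>x. cinner (f x) (g x))"
proof -
  have "cinner (f x) (g x) =
      complex_of_real (((norm (f x + g x))\<^sup>2 - (norm (f x))\<^sup>2 - (norm (g x))\<^sup>2) / 2) +
      \<i> * complex_of_real (((norm ((- \<i>) *\<^sub>C f x + g x))\<^sup>2 - (norm ((- \<i>) *\<^sub>C f x))\<^sup>2 - (norm (g x))\<^sup>2) / 2)"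
    for x
    using complex_eq[of "cinner (f x) (g x)"]
    by (simp only: Im_cinner Re_cinner_polarization)
  then show ?thesis
    by (simp only:) (intro continuous_intros continuous_on_scaleC assms; simp)
qed

section \<open>Passing from a dense subset to the whole space\<close>

text \<open>The closed set where \<open>P\<close> holds contains \<open>D\<close>, hence its
  closure. All transfers from the common domain to the whole space rest on this.\<close>

lemma dense_closed_induct:
  assumes "closure D = UNIV" and "closed {x. P x}" and "\<And>x. x \<in> D \<Longrightarrow> P x"
  shows "\<forall>x. P x"
  using closure_minimal[of D "{x. P x}"] assms by auto

lemma dense_continuous_eq:
  fixes f g :: "'a::topological_space \<Rightarrow> 'b::t2_space"
  assumes "closure D = UNIV" and "continuous_on UNIV f" and "continuous_on UNIV g"
    and "\<And>x. x \<in> D \<Longrightarrow> f x = g x"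
  shows "\<forall>x. f x = g x"
  using assms(1) closed_Collect_eq[OF assms(2,3)] assms(4) by (rule dense_closed_induct)

text \<open>By continuity the equality extends to all \<open>x\<close>; the choice
  \<open>x = z - w\<close> then makes the norm of \<open>z - w\<close> vanish.\<close>

lemma dense_cinner_cancel:
  fixes z w :: "'a::complex_hilbert_space"
  assumes "closure D = UNIV" and "\<And>x. x \<in> D \<Longrightarrow> cinner x z = cinner x w"
  shows "z = w"
proof -
  have "\<forall>x. cinner x z = cinner x w"
    by (rule dense_continuous_eq[OF assms(1)])
      (intro continuous_on_cinner continuous_intros assms(2); assumption)+
  then have "cinner (z - w) (z - w) = 0"
    by (simp add: cinner_diff_right)
  then show ?thesis
    by (simp add: cinner_self)
qed

section \<open>Operators\<close>

lemma operator_eqI: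
  assumes "dom T = dom U" and "\<And>x. x \<in> dom T \<Longrightarrow> T \<cdot> x = U \<cdot> x"
  shows "T = U"
proof
  show "T x = U x" for x
    using assms by (cases "x \<in> dom T") (force simp: domIff)+
qed

lemma dom_op_add [simp]: "dom (T \<oplus> U) = dom T \<inter> dom U"
  by (auto simp: op_add_def dom_def restrict_map_def)

lemma op_add_apply: "x \<in> dom T \<Longrightarrow> x \<in> dom U \<Longrightarrow> (T \<oplus> U) \<cdot> x = T \<cdot> x + U \<cdot> x"
  by (simp add: op_add_def)

lemma dom_op_uminus [simp]: "dom (\<ominus> T) = dom T"
  by (auto simp: op_uminus_def dom_def restrict_map_def)

lemma op_uminus_apply: "x \<in> dom T \<Longrightarrow> (\<ominus> T) \<cdot> x = - (T \<cdot> x)"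
  by (simp add: op_uminus_def)

lemma linear_operatorD:
  assumes "linear_operator T" and "x \<in> dom T" and "y \<in> dom T"
  shows "x + y \<in> dom T" and "c *\<^sub>C x \<in> dom T" and "T \<cdot> (x + y) = T \<cdot> x + T \<cdot> y"
    and "T \<cdot> (c *\<^sub>C x) = c *\<^sub>C (T \<cdot> x)" and "x - y \<in> dom T" and "T \<cdot> (x - y) = T \<cdot> x - T \<cdot> y"
proof -
  note lin = assms(1)[unfolded linear_operator_def]
  show *: "x + y \<in> dom T" "c *\<^sub>C x \<in> dom T" "T \<cdot> (x + y) = T \<cdot> x + T \<cdot> y"
    "T \<cdot> (c *\<^sub>C x) = c *\<^sub>C (T \<cdot> x)" for c
    using lin assms(2,3) complex_vector.subspace_add complex_vector.subspace_scale by blast+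
  show d: "x - y \<in> dom T"
    using lin assms(2,3) complex_vector.subspace_diff by blast
  have "T \<cdot> (x - y + y) = T \<cdot> (x - y) + T \<cdot> y"
    using lin d assms(3) by blast
  then show "T \<cdot> (x - y) = T \<cdot> x - T \<cdot> y"
    by simp
qed

text \<open>Covers the half difference and the half sum of the given pair by one argument.\<close>

lemma linear_operatorI_scaled_sum:
  assumes "linear_operator T" and "linear_operator U" and "dom T = dom U" and "dom V = dom T"
    and V: "\<And>x. x \<in> dom T \<Longrightarrow> V \<cdot> x = a *\<^sub>C (T \<cdot> x) + b *\<^sub>C (U \<cdot> x)"
  shows "linear_operator V"
  unfolding linear_operator_def
proof (intro conjI ballI allI)
  note T = linear_operatorD[OF assms(1)] and U = linear_operatorD[OF assms(2)]
  show "complex_vector.subspace (dom V)"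
    using assms by (simp add: linear_operator_def)
  show "V \<cdot> (x + y) = V \<cdot> x + V \<cdot> y" if "x \<in> dom V" "y \<in> dom V" for x y
    using that assms(3,4) T(1,3)[of x y] U(3)[of x y]
    by (simp add: V scaleC_add_right)
  show "V \<cdot> (c *\<^sub>C x) = c *\<^sub>C (V \<cdot> x)" if "x \<in> dom V" for c x
    using that assms(3,4) T(2,4)[of x x c] U(4)[of x x c]
    by (simp add: V scaleC_add_right scaleC_scaleC mult.commute)
qed

section \<open>Bounded operators and extension by continuity\<close>

lemma bounded_operator_continuous:
  assumes "bounded_operator S"
  shows "continuous_on UNIV (\<lambda>x. S \<cdot> x)"
proof -
  obtain C where C: "norm (S \<cdot> x) \<le> C * norm x" for x
    using assms unfolding bounded_operator_def by blast
  have S: "linear_operator S" "x \<in> dom S" for x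
    using assms unfolding bounded_operator_def by auto
  note lin = linear_operatorD[OF S(1,2,2)]
  have "bounded_linear (\<lambda>x. S \<cdot> x)"
  proof (rule bounded_linear_intro[where K = C])
    show "S \<cdot> (r *\<^sub>R x) = r *\<^sub>R (S \<cdot> x)" for r x
      using lin(4)[of "complex_of_real r" x] by (simp add: scaleC_of_real)
  qed (use lin(3) C in \<open>auto simp: mult.commute\<close>)
  then show ?thesis
    by (rule linear_continuous_on)
qed

text \<open>A bounded linear map is Lipschitz, hence uniformly continuous, and completeness of the
  space extends it continuously to the closure of its domain. Linearity and the bound survive by
  density.\<close>

lemma bounded_extension:
  fixes B :: "'a::complex_hilbert_space operator"
  assumes lin: "linear_operator B" and dense: "closure (dom B) = UNIV"
    and bound: "\<And>x. x \<in> dom B \<Longrightarrow> norm (B \<cdot> x) \<le> C * norm x"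
  obtains S where "bounded_operator S" and "B \<subseteq>\<^sub>m S"
proof -
  note B = linear_operatorD[OF lin]
  \<comment> \<open>A Lipschitz constant must be nonnegative, whereas \<open>C\<close> is an
    arbitrary real; hence the absolute value.\<close>
  have "\<bar>C\<bar>-lipschitz_on (dom B) (\<lambda>x. B \<cdot> x)"
  proof (rule lipschitz_onI)
    fix x y assume xy: "x \<in> dom B" "y \<in> dom B"
    have "norm (B \<cdot> x - B \<cdot> y) \<le> C * norm (x - y)"
      using bound[OF B(5)[OF xy]] B(6)[OF xy] by simp
    also have "\<dots> \<le> \<bar>C\<bar> * norm (x - y)"
      by (intro mult_right_mono) auto
    finally show "dist (B \<cdot> x) (B \<cdot> y) \<le> \<bar>C\<bar> * dist x y"
      by (simp add: dist_norm)
  qed simp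
  then have "uniformly_continuous_on (dom B) (\<lambda>x. B \<cdot> x)"
    by (rule lipschitz_on_uniformly_continuous)
  then obtain s where "uniformly_continuous_on (closure (dom B)) s"
    and ext: "\<And>x. x \<in> dom B \<Longrightarrow> s x = B \<cdot> x"
    by (rule uniformly_continuous_on_extension_on_closure) (metis)
  then have s: "continuous_on UNIV s"
    using dense uniformly_continuous_imp_continuous by auto
  have s_comp: "continuous_on UNIV (\<lambda>x. s (f x))" if "continuous_on UNIV f"
    for f :: "'a \<Rightarrow> 'a"
    using continuous_on_compose2[OF s that] by simp
  \<comment> \<open>Additivity is extended one variable at a time: first in \<open>y\<close> with
    \<open>x\<close> in the domain, then in \<open>x\<close> with \<open>y\<close>
    arbitrary.\<close>
  have "\<forall>y. s (x + y) = s x + s y" if x: "x \<in> dom B" for x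
  proof (rule dense_continuous_eq[OF dense])
    show "s (x + y) = s x + s y" if "y \<in> dom B" for y
      using B(1,3)[OF x that] x that by (simp add: ext)
  qed (intro continuous_intros s_comp)+
  then have "\<forall>x. s (x + y) = s x + s y" for y
    by (intro dense_continuous_eq[OF dense] continuous_intros s_comp) blast
  moreover have "\<forall>x. s (c *\<^sub>C x) = c *\<^sub>C s x" for c
  proof (rule dense_continuous_eq[OF dense])
    show "s (c *\<^sub>C x) = c *\<^sub>C s x" if "x \<in> dom B" for x
      using B(2,4)[OF that that] that by (simp add: ext)
  qed (intro continuous_on_id continuous_on_scaleC s_comp)+
  moreover have "\<forall>x. norm (s x) \<le> C * norm x"
    using dense
  proof (rule dense_closed_induct)
    show "closed {x. norm (s x) \<le> C * norm x}"
      by (intro closed_Collect_le continuous_intros s)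
  qed (simp add: ext bound)
  ultimately have "bounded_operator (\<lambda>x. Some (s x))"
    unfolding bounded_operator_def linear_operator_def
    by (auto simp: dom_def complex_vector.subspace_UNIV)
  moreover have "B \<subseteq>\<^sub>m (\<lambda>x. Some (s x))"
    using ext by (auto simp: map_le_def)
  ultimately show thesis
    using that by blast
qed

section \<open>Adjoints, skew-symmetry and self-adjointness\<close>

text \<open>Density allows at most one \<open>z\<close> for each \<open>y\<close>, so the
  description in \<open>adjoint_op\<close> picks exactly that vector and can be eliminated.\<close>

lemma adjoint_op_eq_Some_iff:
  assumes "densely_defined T"
  shows "adjoint_op T y = Some z \<longleftrightarrow> (\<forall>x\<in>dom T. cinner (T \<cdot> x) y = cinner x z)"
    (is "_ \<longleftrightarrow> ?P z")
proof -
  have unique: "z = w" if "?P z" "?P w" for z w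
    using that assms by (intro dense_cinner_cancel[of "dom T"]) (auto simp: densely_defined_def)
  have the: "(THE z. ?P z) = z" if "?P z" for z
    by (rule the_equality) (use that unique in blast)+
  have adj: "adjoint_op T y = (if \<exists>z. ?P z then Some (THE z. ?P z) else None)"
    by (simp add: adjoint_op_def restrict_map_def)
  show ?thesis
  proof
    assume "adjoint_op T y = Some z"
    then obtain w where w: "?P w" and "(THE z. ?P z) = z"
      unfolding adj by (auto simp only: split: if_splits)
    then show "?P z"
      using the[OF w] by blast
  next
    assume z: "?P z"
    then have "\<exists>z. ?P z"
      by blast
    then show "adjoint_op T y = Some z"
      unfolding adj using the[OF z] by (simp only: if_True)
  qed
qed

text \<open>The inclusion says that the adjoint takes the value \<open>- (L \<cdot> y)\<close> at
  each \<open>y\<close> in \<open>dom L\<close>; unfolding the adjoint there gives the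
  identity.\<close>

lemma skew_symmetric_iff:
  "skew_symmetric L \<longleftrightarrow> linear_operator L \<and> densely_defined L \<and>
    (\<forall>x\<in>dom L. \<forall>y\<in>dom L. cinner (L \<cdot> x) y = - cinner x (L \<cdot> y))"
proof -
  have "\<ominus> L \<subseteq>\<^sub>m adjoint_op L \<longleftrightarrow> (\<forall>x\<in>dom L. \<forall>y\<in>dom L. cinner (L \<cdot> x) y = - cinner x (L \<cdot> y))"
    if dense: "densely_defined L"
  proof -
    have "\<ominus> L \<subseteq>\<^sub>m adjoint_op L \<longleftrightarrow> (\<forall>y\<in>dom L. adjoint_op L y = Some (- (L \<cdot> y)))"
      by (auto simp: map_le_def op_uminus_def restrict_map_def dom_def)
    then show ?thesis
      unfolding adjoint_op_eq_Some_iff[OF dense] by (auto simp: cinner_minus_right)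
  qed
  then show ?thesis
    unfolding skew_symmetric_def by blast
qed

text \<open>Since \<open>S\<close> is defined everywhere, symmetry already makes
  \<open>S \<cdot> y\<close> the value of the adjoint at every \<open>y\<close>, so the two domains
  agree automatically.\<close>

lemma self_adjoint_iff_symmetric:
  assumes "bounded_operator S"
  shows "self_adjoint S \<longleftrightarrow> (\<forall>x y. cinner (S \<cdot> x) y = cinner x (S \<cdot> y))"
proof -
  have dom: "dom S = UNIV" and lin: "linear_operator S"
    using assms by (auto simp: bounded_operator_def)
  then have dense: "densely_defined S"
    by (simp add: densely_defined_def)
  have S: "S y = Some (S \<cdot> y)" for y
    using dom by (metis UNIV_I domIff option.exhaust_sel)
  have "adjoint_op S = S \<longleftrightarrow> (\<forall>y. adjoint_op S y = Some (S \<cdot> y))"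
    using S by (metis ext)
  then show ?thesis
    using lin dense unfolding self_adjoint_def adjoint_op_eq_Some_iff[OF dense] dom by auto
qed

section \<open>The decomposition\<close>

text \<open>The last fact drives uniqueness and positivity: \<open>L\<close> cancels in the sum of
  the pair, which therefore sees only \<open>S\<close>.\<close>

lemma decompositionD:
  assumes "decomposition T T' L S"
  shows "dom T = dom L" and "dom T' = dom L" and "closure (dom L) = UNIV"
    and "bounded_operator S" and "dom S = UNIV"
    and "x \<in> dom L \<Longrightarrow> T \<cdot> x = L \<cdot> x + S \<cdot> x"
    and "x \<in> dom L \<Longrightarrow> T' \<cdot> x = - (L \<cdot> x) + S \<cdot> x"
    and "x \<in> dom L \<Longrightarrow> (T \<oplus> T') \<cdot> x = 2 *\<^sub>R (S \<cdot> x)"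
proof -
  note d = assms[unfolded decomposition_def]
  show S: "bounded_operator S" "dom S = UNIV"
    using d by (auto simp: bounded_operator_def)
  show dom: "dom T = dom L" "dom T' = dom L"
    using d S by auto
  show "closure (dom L) = UNIV"
    using d by (auto simp: skew_symmetric_def densely_defined_def)
  show T: "T \<cdot> x = L \<cdot> x + S \<cdot> x" "T' \<cdot> x = - (L \<cdot> x) + S \<cdot> x" if "x \<in> dom L"
    using that d S by (auto simp: op_add_apply op_uminus_apply)
  show "(T \<oplus> T') \<cdot> x = 2 *\<^sub>R (S \<cdot> x)" if "x \<in> dom L"
    using that T dom by (simp add: op_add_apply scaleR_2)
qed

text \<open>Moving \<open>L\<close> across the scalar product changes its sign and moving
  \<open>S\<close> does not, which turns \<open>L + S\<close> into \<open>- L + S\<close>.\<close>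

lemma decomposition_imp_cond_a:
  assumes "decomposition T T' L S"
  shows "cond_a T T'"
proof -
  note d = decompositionD[OF assms]
  have "cinner (L \<cdot> x) y = - cinner x (L \<cdot> y)" if "x \<in> dom L" "y \<in> dom L" for x y
    using that assms by (auto simp: decomposition_def skew_symmetric_iff)
  moreover have "cinner (S \<cdot> x) y = cinner x (S \<cdot> y)" for x y
    using assms self_adjoint_iff_symmetric[OF d(4)] by (auto simp: decomposition_def)
  ultimately have "cinner (T \<cdot> x) y = cinner x (T' \<cdot> y)" if "x \<in> dom L" "y \<in> dom L" for x y
    using that by (simp add: d(6,7) cinner_add_left cinner_diff_right)
  then show ?thesis
    using d(1,2,3) unfolding cond_a_def by simp
qed

lemma decomposition_imp_cond_b:
  assumes "decomposition T T' L S"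
  shows "cond_b T T'"
proof -
  note d = decompositionD[OF assms]
  obtain C where C: "norm (S \<cdot> x) \<le> C * norm x" for x
    using d(4) by (auto simp: bounded_operator_def)
  \<comment> \<open>\<open>cond_b\<close> asks for a positive constant, which \<open>C\<close> need
    not be.\<close>
  have "norm (S \<cdot> x) \<le> max C 1 * norm x" for x
    using C[of x] mult_right_mono[of C "max C 1" "norm x"] by simp
  then have "norm ((T \<oplus> T') \<cdot> x) \<le> 2 * max C 1 * norm x" if "x \<in> dom (T \<oplus> T')" for x
    using that d by (simp add: mult.assoc)
  then show ?thesis
    unfolding cond_b_def by (intro exI[of _ "max C 1"]) auto
qed

lemma decomposition_exists:
  assumes lin: "linear_operator T" "linear_operator T'" and a: "cond_a T T'" and b: "cond_b T T'"
  shows "\<exists>L S. decomposition T T' L S"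
proof -
  have dom: "dom T' = dom T" and dense: "closure (dom T) = UNIV"
    and adj: "\<And>x y. x \<in> dom T \<Longrightarrow> y \<in> dom T \<Longrightarrow> cinner (T \<cdot> x) y = cinner x (T' \<cdot> y)"
    using a by (auto simp: cond_a_def)
  have adj': "cinner (T' \<cdot> x) y = cinner x (T \<cdot> y)" if "x \<in> dom T" "y \<in> dom T" for x y
    using adj[OF that(2,1)] by (metis cinner_commute)
  obtain lam where lam: "\<And>x. x \<in> dom T \<Longrightarrow> norm (T \<cdot> x + T' \<cdot> x) \<le> 2 * lam * norm x"
    using b dom by (auto simp: cond_b_def op_add_apply)
  define L where "L = (\<lambda>x. Some ((1/2) *\<^sub>R (T \<cdot> x - T' \<cdot> x))) |` dom T"
  define B where "B = (\<lambda>x. Some ((1/2) *\<^sub>R (T \<cdot> x + T' \<cdot> x))) |` dom T"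
  have domL: "dom L = dom T" and domB: "dom B = dom T"
    by (auto simp: L_def B_def dom_def restrict_map_def)
  have L: "L \<cdot> x = (1/2) *\<^sub>R (T \<cdot> x - T' \<cdot> x)" and B: "B \<cdot> x = (1/2) *\<^sub>R (T \<cdot> x + T' \<cdot> x)"
    if "x \<in> dom T" for x
    using that by (simp_all add: L_def B_def)
  \<comment> \<open>Links the real factors in \<open>L\<close> and \<open>B\<close> to the complex
    coefficients of \<open>linear_operatorI_scaled_sum\<close>.\<close>
  have half: "complex_of_real (1/2) *\<^sub>C x = (1/2) *\<^sub>R x"
    "complex_of_real (- (1/2)) *\<^sub>C x = - ((1/2) *\<^sub>R x)" for x :: 'a
    by (simp_all only: scaleC_of_real scaleR_minus_left)
  have linL: "linear_operator L"
    by (rule linear_operatorI_scaled_sum[OF lin dom[symmetric] domL,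
          where a = "complex_of_real (1/2)" and b = "complex_of_real (- (1/2))"])
      (simp only: L half scaleR_diff_right add_uminus_conv_diff)
  have linB: "linear_operator B"
    by (rule linear_operatorI_scaled_sum[OF lin dom[symmetric] domB,
          where a = "complex_of_real (1/2)" and b = "complex_of_real (1/2)"])
      (simp only: B half scaleR_add_right)
  \<comment> \<open>Crossing the scalar product exchanges \<open>T\<close> and \<open>T'\<close>, so
    their difference changes sign.\<close>
  have skew: "skew_symmetric L"
    unfolding skew_symmetric_iff densely_defined_def domL
    using linL dense by (auto simp: L cinner_scaleR_left cinner_scaleR_right cinner_diff_left
        cinner_diff_right adj adj' algebra_simps)
  \<comment> \<open>The factor \<open>1/2\<close> in \<open>B\<close> absorbs the 2 of
    \<open>cond_b\<close>.\<close>
  have "norm (B \<cdot> x) \<le> lam * norm x" if "x \<in> dom B" for x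
    using lam[of x] that by (simp add: B domB)
  then obtain S where S: "bounded_operator S" and "B \<subseteq>\<^sub>m S"
    using bounded_extension linB dense domB by metis
  then have SB: "S \<cdot> x = B \<cdot> x" if "x \<in> dom T" for x
    using that domB by (auto simp: map_le_def)
  have domS: "dom S = UNIV"
    using S by (simp add: bounded_operator_def)
  note cont = bounded_operator_continuous[OF S]
  \<comment> \<open>On the domain the exchange of \<open>T\<close> and \<open>T'\<close> leaves
    their sum unchanged; symmetry then extends in \<open>y\<close> first and in \<open>x\<close>
    afterwards.\<close>
  have "\<forall>y. cinner (S \<cdot> x) y = cinner x (S \<cdot> y)" if x: "x \<in> dom T" for x
  proof (rule dense_continuous_eq[OF dense])
    show "cinner (S \<cdot> x) y = cinner x (S \<cdot> y)" if "y \<in> dom T" for y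
      using x that by (simp add: SB B cinner_scaleR_left cinner_scaleR_right cinner_add_left
          cinner_add_right adj adj')
  qed (intro continuous_on_cinner continuous_intros cont)+
  then have "\<forall>x. cinner (S \<cdot> x) y = cinner x (S \<cdot> y)" for y
    by (intro dense_continuous_eq[OF dense] continuous_on_cinner continuous_intros cont) blast
  then have sa: "self_adjoint S"
    using self_adjoint_iff_symmetric[OF S] by blast
  have sum: "T \<cdot> x = L \<cdot> x + S \<cdot> x" "T' \<cdot> x = - (L \<cdot> x) + S \<cdot> x" if "x \<in> dom T" for x
    using that scaleR_half_double[of "T \<cdot> x"] scaleR_half_double[of "T' \<cdot> x"]
    by (auto simp: L SB B scaleR_add_right scaleR_diff_right)
  have "T = L \<oplus> S"
    by (rule operator_eqI) (use sum domL domS in \<open>auto simp: op_add_apply\<close>)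
  moreover have "T' = \<ominus> L \<oplus> S"
    by (rule operator_eqI) (use sum dom domL domS in \<open>auto simp: op_add_apply op_uminus_apply\<close>)
  ultimately show ?thesis
    using skew S sa unfolding decomposition_def by blast
qed

text \<open>Both \<open>S\<close> and \<open>S'\<close> are half the sum of the pair on a dense
  domain, so they agree everywhere by continuity. Subtracting them from \<open>T\<close> then
  identifies \<open>L\<close> and \<open>L'\<close>.\<close>

lemma decomposition_unique:
  assumes "decomposition T T' L S" and "decomposition T T' L' S'"
  shows "L = L'" and "S = S'"
proof -
  note d = decompositionD[OF assms(1)] and d' = decompositionD[OF assms(2)]
  have dom: "dom L' = dom L"
    using d(1) d'(1) by simp
  have S: "\<forall>x. S \<cdot> x = S' \<cdot> x"
  proof (rule dense_continuous_eq[OF d(3)])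
    show "S \<cdot> x = S' \<cdot> x" if "x \<in> dom L" for x
      using that d(8)[of x] d'(8)[of x] dom by simp
  qed (rule bounded_operator_continuous d(4) d'(4))+
  then show "S = S'"
    using d(5) d'(5) by (intro operator_eqI) auto
  show "L = L'"
  proof (rule operator_eqI)
    show "L \<cdot> x = L' \<cdot> x" if "x \<in> dom L" for x
      using that d(6)[of x] d'(6)[of x] dom S by simp
  qed (simp add: dom)
qed

text \<open>On \<open>dom L\<close> the sum of the pair is twice \<open>S\<close>, so
  \<open>cond_c\<close> is the positivity inequality for \<open>S\<close> restricted to a dense set;
  closedness of the inequality extends it.\<close>

lemma decomposition_strictly_positive_iff:
  assumes "decomposition T T' L S"
  shows "strictly_positive \<mu> S \<longleftrightarrow> cond_c \<mu> T T'"
proof -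
  note d = decompositionD[OF assms]
  note cont = bounded_operator_continuous[OF d(4)]
  let ?P = "\<lambda>x. complex_of_real (\<mu> * (norm x)\<^sup>2) \<le> cinner (S \<cdot> x) x"
  \<comment> \<open>The complex order compares real parts and equates imaginary parts; each of the
    two conditions is closed.\<close>
  have "closed {x. \<mu> * (norm x)\<^sup>2 \<le> Re (cinner (S \<cdot> x) x)}"
    by (intro closed_Collect_le continuous_intros continuous_on_cinner cont)
  moreover have "closed {x. Im (cinner (S \<cdot> x) x) = 0}"
    by (intro closed_Collect_eq continuous_intros continuous_on_cinner cont)
  ultimately have "closed ({x. \<mu> * (norm x)\<^sup>2 \<le> Re (cinner (S \<cdot> x) x)} \<inter>
      {x. Im (cinner (S \<cdot> x) x) = 0})"
    by (rule closed_Int)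
  also have "\<dots> = {x. ?P x}"
    by (auto simp: less_eq_complex_def)
  finally have "closed {x. ?P x}" .
  then have "(\<forall>x\<in>dom L. ?P x) \<longleftrightarrow> (\<forall>x. ?P x)"
    using dense_closed_induct[OF d(3), of ?P] by blast
  moreover have "cond_c \<mu> T T' \<longleftrightarrow> (\<forall>x\<in>dom L. ?P x)"
    using d by (simp add: cond_c_def cinner_scaleR_left less_eq_complex_def)
  ultimately show ?thesis
    by (simp add: strictly_positive_def d(5))
qed

theorem theorem3p1:
  fixes T\<^sub>0 T\<^sub>0' :: "'a::complex_hilbert_space operator"
  assumes "linear_operator T\<^sub>0" and "densely_defined T\<^sub>0"
    and "linear_operator T\<^sub>0'" and "densely_defined T\<^sub>0'"
  shows
    "(cond_a T\<^sub>0 T\<^sub>0' \<and> cond_b T\<^sub>0 T\<^sub>0' \<longleftrightarrow> (\<exists>L\<^sub>0 S. decomposition T\<^sub>0 T\<^sub>0' L\<^sub>0 S)) \<and>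
     (\<forall>L\<^sub>0 S L\<^sub>0' S'. decomposition T\<^sub>0 T\<^sub>0' L\<^sub>0 S \<and> decomposition T\<^sub>0 T\<^sub>0' L\<^sub>0' S'
        \<longrightarrow> L\<^sub>0 = L\<^sub>0' \<and> S = S') \<and>
     (\<forall>\<mu>>0.
        (cond_a T\<^sub>0 T\<^sub>0' \<and> cond_b T\<^sub>0 T\<^sub>0' \<and> cond_c \<mu> T\<^sub>0 T\<^sub>0' \<longleftrightarrow>
          (\<exists>L\<^sub>0 S. decomposition T\<^sub>0 T\<^sub>0' L\<^sub>0 S \<and> strictly_positive \<mu> S)) \<and>
        (\<forall>L\<^sub>0 S L\<^sub>0' S'.
           decomposition T\<^sub>0 T\<^sub>0' L\<^sub>0 S \<and> strictly_positive \<mu> S \<and>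
           decomposition T\<^sub>0 T\<^sub>0' L\<^sub>0' S' \<and> strictly_positive \<mu> S'
           \<longrightarrow> L\<^sub>0 = L\<^sub>0' \<and> S = S'))"
proof -
  have ex: "cond_a T\<^sub>0 T\<^sub>0' \<and> cond_b T\<^sub>0 T\<^sub>0' \<longleftrightarrow> (\<exists>L\<^sub>0 S. decomposition T\<^sub>0 T\<^sub>0' L\<^sub>0 S)"
    using decomposition_exists[OF assms(1,3)] decomposition_imp_cond_a decomposition_imp_cond_b
    by blast
  \<comment> \<open>Positivity of \<open>S\<close> in any decomposition amounts to
    \<open>cond_c\<close> for the pair, so this follows from the first equivalence.\<close>
  moreover have "cond_a T\<^sub>0 T\<^sub>0' \<and> cond_b T\<^sub>0 T\<^sub>0' \<and> cond_c \<mu> T\<^sub>0 T\<^sub>0' \<longleftrightarrow>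
      (\<exists>L\<^sub>0 S. decomposition T\<^sub>0 T\<^sub>0' L\<^sub>0 S \<and> strictly_positive \<mu> S)" for \<mu>
    using ex decomposition_strictly_positive_iff by blast
  ultimately show ?thesis
    using decomposition_unique by blast
qed

end
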